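(* For $N\ge0$ and $\mu\in\{0,2\}$, with all unspecified sums over $(i,j,k,l)\in\mathbb{N}^4$ with $i+j+k+l=N$ and $\begin{bmatrix}N\\ i,j,k,l\end{bmatrix}=\begin{bmatrix}N\\ i,j,k,l\end{bmatrix}_{q^6}$: $$P_{3N+\mu}(0,t,u,0;q)=\Big(1+\tfrac{\mu}{2}tq^2\Big)\sum\begin{bmatrix}N\\ i,j,k,l\end{bmatrix}t^iu^jq^{3i^2+(3\mu-1)i+3j^2+j+3k},$$ $$P_{3N+\mu}(s,0,0,v;q)=\Big(1+\tfrac{\mu}{2}sq\Big)\sum\begin{bmatrix}N\\ i,j,k,l\end{bmatrix}s^iv^jq^{3i^2+(3\mu-2)i+3j^2+2j+3k},$$ $$P_{3N+\mu}(s,0,u,0;q)=\Big(1+\tfrac{\mu}{2}sq\Big)\sum\begin{bmatrix}N\\ i,j,k,l\end{bmatrix}s^iu^jq^{3i^2+(3\mu-2)i+3j^2+j+3k},$$ $$P_{3N+\mu}(0,t,0,v;q)=\Big(1+\tfrac{\mu}{2}tq^2\Big)\sum\begin{bmatrix}N\\ i,j,k,l\end{bmatrix}t^iv^jq^{3i^2+(3\mu-1)i+3j^2+2j+3k},$$ and $$P_{3N+1}(0,t,u,0;q)=\sum\begin{bmatrix}N\\ i,j,k,l\end{bmatrix}t^iu^jq^{3i^2-i+3j^2+j+3k},$$ $$P_{3N+1}(s,0,0,v;q)=\sum\begin{bmatrix}N\\ i,j,k,l\end{bmatrix}q^{3i^2-2i+3j^2+2j+3k}\big(s^iv^j+s^{j+1}v^iq^{i-j+3N+1}\big),$$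 $$P_{3N+1}(s,0,u,0;q)=\sum\begin{bmatrix}N\\ i,j,k,l\end{bmatrix}q^{3i^2-2i+3j^2+j+3k}\big(s^iu^j+s^{j+1}u^iq^{3N+1}\big),$$ $$P_{3N+1}(0,t,0,v;q)=\sum\begin{bmatrix}N\\ i,j,k,l\end{bmatrix}t^iv^jq^{3i^2-i+3j^2+2j+3k}.$$
   Context: For $M\ge0$, $\mathcal{DS}^3_{M,\infty}$ is the set of partitions into distinct parts with largest part $\le M$ in which for no $l\ge0$ are both $3l+1$ and $3l+2$ parts. For $\pi=(\pi_1>\pi_2>\cdots)$ and $i=1,2$, $o_i(\pi)$ (resp. $e_i(\pi)$) is the number of odd-indexed parts $\pi_1,\pi_3,\dots$ (resp. even-indexed parts $\pi_2,\pi_4,\dots$) that are $\equiv i\pmod 3$. Define $P_{M}(s,t,u,v;q)=\sum_{\pi\in\mathcal{DS}^3_{M,\infty}}s^{o_1(\pi)}t^{o_2(\pi)}u^{e_1(\pi)}v^{e_2(\pi)}q^{|\pi|}$, where $|\pi|$ is the sum of parts. $q$-multinomial: $\begin{bmatrix}N\\ n_1,\dots,n_m\end{bmatrix}_q=\frac{(q;q)_N}{(q;q)_{n_1}\cdots(q;q)_{n_m}}$, $(q;q)_n=\prod_{i=1}^n(1-q^i)$. *)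

theory Defs
  imports "HOL-Computational_Algebra.Polynomial"
begin

text \<open>
  The partition polynomials and \<open>q\<close>-multinomials have integer coefficients. They are
  evaluated at arbitrary elements of an arbitrary commutative ring; taking a polynomial ring over
  the integers and its indeterminates gives the formal polynomials.
\<close>

text \<open>A partition into distinct parts is the strictly decreasing list of its parts.\<close>

definition DS3 :: "nat \<Rightarrow> nat list set" where
  "DS3 M = {\<pi>. sorted_wrt (>) \<pi> \<and> (\<forall>x\<in>set \<pi>. 0 < x \<and> x \<le> M)
                \<and> (\<forall>l. \<not> (3 * l + 1 \<in> set \<pi> \<and> 3 * l + 2 \<in> set \<pi>))}"

lemma finite_DS3: "finite (DS3 M)"
proof (rule finite_subset)
  have "\<pi> = rev (sorted_list_of_set (set \<pi>))" if "sorted_wrt (>) \<pi>" for \<pi> :: "nat list"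
  proof -
    have "sorted_wrt (<) (rev \<pi>)"
      using that by (simp add: sorted_wrt_rev)
    then have "sorted_list_of_set (set (rev \<pi>)) = rev \<pi>"
      using sorted_list_of_set.idem_if_sorted_distinct strict_sorted_iff by blast
    then show ?thesis by simp
  qed
  then show "DS3 M \<subseteq> (\<lambda>A. rev (sorted_list_of_set A)) ` Pow {0..M}"
    by (force simp: DS3_def image_iff)
qed simp

text \<open>
  The part \<open>\<pi>\<^sub>k\<close> of the mathematical notation is \<open>\<pi> ! (k - 1)\<close>, so the
  odd-indexed parts sit at even list positions and vice versa.
\<close>

definition odd_idx :: "nat \<Rightarrow> nat list \<Rightarrow> nat" where
  "odd_idx i \<pi> = card {k. k < length \<pi> \<and> even k \<and> \<pi> ! k mod 3 = i}"

definition even_idx :: "nat \<Rightarrow> nat list \<Rightarrow> nat" where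
  "even_idx i \<pi> = card {k. k < length \<pi> \<and> odd k \<and> \<pi> ! k mod 3 = i}"

definition P :: "nat \<Rightarrow> 'a \<Rightarrow> 'a \<Rightarrow> 'a \<Rightarrow> 'a \<Rightarrow> 'a \<Rightarrow> 'a::comm_ring_1" where
  "P M s t u v q = (\<Sum>\<pi>\<in>DS3 M. s ^ odd_idx 1 \<pi> * t ^ odd_idx 2 \<pi> *
       u ^ even_idx 1 \<pi> * v ^ even_idx 2 \<pi> * q ^ sum_list \<pi>)"

definition qpoch :: "'a::comm_ring_1 \<Rightarrow> nat \<Rightarrow> 'a" where
  "qpoch q n = (\<Prod>i=1..n. 1 - q ^ i)"

text \<open>
  The quotient is formed in \<open>\<int>[q]\<close>, where it is exact when the lower entries sum
  to the upper one, and then evaluated. This gives a meaning to the multinomial when the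
  denominator is not invertible, e.g. at roots of unity; see the two lemmas below.
\<close>

definition qmultinomial :: "'a::comm_ring_1 \<Rightarrow> nat \<Rightarrow> nat list \<Rightarrow> 'a" where
  "qmultinomial q N ns =
     poly (map_poly of_int
       (qpoch [:0, 1:] N div prod_list (map (qpoch [:0, 1:]) ns) :: int poly)) q"

lemma qpoch_Suc: "qpoch q (Suc n) = (1 - q ^ Suc n) * qpoch q n"
  by (simp add: qpoch_def mult.commute)

lemma qpoch_mult_dvd: "qpoch q a * qpoch q b dvd qpoch q (a + b)"
proof (induction "a + b" arbitrary: a b)
  case 0
  then show ?case by (simp add: qpoch_def)
next
  case (Suc n)
  show ?case
  proof (cases "a = 0 \<or> b = 0")
    case True
    then show ?thesis by (auto simp: qpoch_def)
  next
    case False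
    then obtain a' b' where ab: "a = Suc a'" "b = Suc b'"
      by (metis not0_implies_Suc)
    have n: "n = a' + b" "n = a + b'" using Suc.hyps(2) ab by auto
    have 1: "qpoch q a * qpoch q b dvd (1 - q ^ a) * qpoch q n"
    proof -
      have "(1 - q ^ a) * (qpoch q a' * qpoch q b) dvd (1 - q ^ a) * qpoch q n"
        using Suc.hyps(1)[OF n(1)] n by (auto intro: mult_dvd_mono)
      then show ?thesis by (simp add: ab(1) qpoch_Suc[of q a'] mult.assoc)
    qed
    have 2: "qpoch q a * qpoch q b dvd (1 - q ^ b) * qpoch q n"
    proof -
      have "(1 - q ^ b) * (qpoch q a * qpoch q b') dvd (1 - q ^ b) * qpoch q n"
        using Suc.hyps(1)[OF n(2)] n by (auto intro: mult_dvd_mono)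
      then show ?thesis by (simp add: ab(2) qpoch_Suc[of q b'] mult_ac)
    qed
    have "qpoch q (a + b) = (1 - q ^ a * q ^ b) * qpoch q n"
      unfolding Suc.hyps(2)[symmetric] qpoch_Suc by (simp only: Suc.hyps(2) power_add)
    also have "\<dots> = (1 - q ^ a) * qpoch q n + q ^ a * ((1 - q ^ b) * qpoch q n)"
      by (simp add: algebra_simps)
    finally show ?thesis using 1 2 by (simp add: dvd_add dvd_mult)
  qed
qed

lemma prod_list_qpoch_dvd: "prod_list (map (qpoch q) ns) dvd qpoch q (sum_list ns)"
proof (induction ns)
  case Nil
  then show ?case by simp
next
  case (Cons a ns)
  then have "qpoch q a * prod_list (map (qpoch q) ns) dvd qpoch q a * qpoch q (sum_list ns)"
    by (rule mult_dvd_mono[OF dvd_refl])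
  also have "\<dots> dvd qpoch q (a + sum_list ns)" by (rule qpoch_mult_dvd)
  finally show ?case by simp
qed

lemma qmultinomial_mult:
  assumes "sum_list ns = N"
  shows "qmultinomial q N ns * prod_list (map (qpoch q) ns) = qpoch q N"
proof -
  define ev where "ev p = poly (map_poly of_int p) q" for p :: "int poly"
  have ev_mult: "ev (p * r) = ev p * ev r" for p r
  proof -
    have "map_poly (of_int :: int \<Rightarrow> 'a) (p * r) = map_poly of_int p * map_poly of_int r"
      by (rule poly_eqI) (simp add: coeff_map_poly coeff_mult)
    then show ?thesis by (simp add: ev_def)
  qed
  have ev_diff: "ev (p - r) = ev p - ev r" for p r
  proof -
    have "map_poly (of_int :: int \<Rightarrow> 'a) (p - r) = map_poly of_int p - map_poly of_int r"
      by (rule poly_eqI) (simp add: coeff_map_poly)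
    then show ?thesis by (simp add: ev_def)
  qed
  have ev_1: "ev 1 = 1" by (simp add: ev_def)
  have ev_X: "ev [:0, 1:] = q" by (simp add: ev_def map_poly_pCons)
  have ev_pow: "ev (p ^ n) = ev p ^ n" for p n
    by (induction n) (simp_all add: ev_mult ev_1)
  have ev_qpoch: "ev (qpoch [:0, 1:] n) = qpoch q n" for n
  proof (induction n)
    case 0
    show ?case by (simp add: qpoch_def ev_1)
  next
    case (Suc n)
    then show ?case
      unfolding qpoch_Suc ev_mult ev_diff ev_pow ev_X ev_1 by simp
  qed
  have ev_prod: "ev (prod_list (map (qpoch [:0, 1:]) ns)) = prod_list (map (qpoch q) ns)"
    by (induction ns) (simp_all add: ev_mult ev_1 ev_qpoch)
  let ?D = "prod_list (map (qpoch [:0, 1:]) ns) :: int poly"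
  have "?D dvd qpoch [:0, 1:] N"
    using prod_list_qpoch_dvd[of "[:0, 1:] :: int poly" ns] assms by simp
  then have "ev (qpoch [:0, 1:] N div ?D) * ev ?D = ev (qpoch [:0, 1:] N)"
    by (simp flip: ev_mult)
  then show ?thesis
    by (simp add: ev_prod ev_qpoch qmultinomial_def ev_def[of "_ div _"])
qed

lemma qmultinomial_eq_divide:
  fixes q :: "'a::field"
  assumes "sum_list ns = N" "prod_list (map (qpoch q) ns) \<noteq> 0"
  shows "qmultinomial q N ns = qpoch q N / prod_list (map (qpoch q) ns)"
  using qmultinomial_mult[OF assms(1), of q] assms(2) by (simp add: nonzero_eq_divide_eq)

definition quads :: "nat \<Rightarrow> (nat \<times> nat \<times> nat \<times> nat) set" where
  "quads N = {(i, j, k, l). i + j + k + l = N}"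

lemma finite_quads: "finite (quads N)"
  by (rule finite_subset[of _ "{..N} \<times> {..N} \<times> {..N} \<times> {..N}"]) (auto simp: quads_def)

text \<open>
  Some exponents of \<open>q\<close> have negative terms, so they are computed in the integers. All
  exponents \<open>e\<close> occurring satisfy \<open>e \<ge> 0\<close>, so nothing is truncated.
\<close>

abbreviation qpow :: "'a::comm_ring_1 \<Rightarrow> int \<Rightarrow> 'a" where
  "qpow q e \<equiv> q ^ nat e"

end

theory Submission
  imports Defs
begin

text \<open>
  Removing the largest part of a partition exchanges \<open>(s, t)\<close> and \<open>(u, v)\<close>, so
  \<open>P\<^sub>3\<^sub>n(s, t, u, v)\<close> and \<open>P\<^sub>3\<^sub>n(u, v, s, t)\<close> satisfy a coupled linear
  recurrence in \<open>n\<close> that involves the variables only through \<open>x = sq + tq\<^sup>2\<close> and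
  \<open>y = uq + vq\<^sup>2\<close>. With \<open>c = q\<^sup>3\<close> its solution is \<open>F\<^sub>n(x, cy)\<close>,
  \<open>F\<^sub>n(y, cx)\<close>, where \<open>F\<^sub>n\<close> is the symmetric polynomial
  \<open>quad_poly c n\<close>. Comparing coefficients of
  \<open>x\<^sup>i y\<^sup>j\<close>, the recurrence for \<open>F\<^sub>n\<close> becomes the Pascal rule for
  q-trinomials in base \<open>c\<^sup>2\<close>, once the sum over \<open>k\<close> is known to be the product
  of the \<open>1 + c\<^sup>r\<close> for \<open>r = 1, ..., n - i - j\<close>. For \<open>\<mu> = 2\<close> the two
  terms \<open>F\<^sub>n(x, cy) + x c\<^sup>n F\<^sub>n(cx, y)\<close> combine to
  \<open>(1 + x) F\<^sub>n(c\<^sup>2 x, cy)\<close>. If one of \<open>s, t\<close> and one of \<open>u, v\<close>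
  vanish, \<open>x\<close> and \<open>y\<close> are monomials, which gives the stated exponents.
\<close>

section \<open>Gaussian binomial coefficients\<close>

text \<open>The Pascal rule serves as definition instead of a quotient of \<open>qpoch\<close>
  values, so that the coefficient exists over every commutative ring.\<close>

fun qbin :: "'a::comm_ring_1 \<Rightarrow> nat \<Rightarrow> nat \<Rightarrow> 'a" where
  "qbin q n 0 = 1"
| "qbin q 0 (Suc k) = 0"
| "qbin q (Suc n) (Suc k) = qbin q n k + q ^ Suc k * qbin q n (Suc k)"

lemma qbin_eq_0: "n < k \<Longrightarrow> qbin q n k = 0"
  by (induction q n k rule: qbin.induct) auto

lemma qbin_self: "qbin q n n = 1"
  by (induction n) (auto simp: qbin_eq_0)

text \<open>Multiplying the Pascal rule by 1 - q^(k+1) and using the hypothesis leaves the factor 1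
  - q^(k+1) q^(n-k). The hypothesis stays explicit because the induction for
  \<open>qbin_absorb_lower\<close> uses this step before that lemma is available.\<close>

lemma qbin_absorb_both_aux:
  assumes "(1 - q ^ Suc k) * qbin q n (Suc k) = (1 - q ^ (n - k)) * qbin q n k"
  shows "(1 - q ^ Suc k) * qbin q (Suc n) (Suc k) = (1 - q ^ Suc n) * qbin q n k"
proof (cases "k \<le> n")
  case True
  then have n: "Suc n = Suc k + (n - k)" by simp
  have "(1 - q ^ Suc k) * qbin q (Suc n) (Suc k)
      = (1 - q ^ Suc k) * qbin q n k + q ^ Suc k * ((1 - q ^ Suc k) * qbin q n (Suc k))"
    by (simp add: algebra_simps)
  also have "\<dots> = (1 - q ^ Suc k * q ^ (n - k)) * qbin q n k"
    unfolding assms by (simp add: algebra_simps)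
  finally show ?thesis by (metis n power_add)
qed (simp add: qbin_eq_0)

lemma qbin_absorb_lower:
  "(1 - q ^ Suc k) * qbin q n (Suc k) = (1 - q ^ (n - k)) * qbin q n k"
proof (induction n arbitrary: k)
  case 0
  show ?case by (cases k) auto
next
  case (Suc n)
  \<comment> \<open>The auxiliary lemma turns the left side of the goal into the right side of this
    identity.\<close>
  have "(1 - q ^ (Suc n - k)) * qbin q (Suc n) k = (1 - q ^ Suc n) * qbin q n k"
  proof (cases k)
    case (Suc k')
    show ?thesis
    proof (cases "k \<le> n")
      case True
      have n: "Suc n = k + (n - k')" using Suc True by simp
      have "(1 - q ^ (Suc n - k)) * qbin q (Suc n) k
          = (1 - q ^ (n - k')) * qbin q n k' + (1 - q ^ (n - k')) * q ^ k * qbin q n k"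
        by (simp add: Suc algebra_simps)
      also have "\<dots> = (1 - q ^ k * q ^ (n - k')) * qbin q n k"
        unfolding Suc.IH[symmetric] Suc by (simp add: algebra_simps)
      finally show ?thesis by (metis n power_add)
    next
      case False
      then have "Suc n - k = 0" "qbin q n k = 0" by (auto simp: qbin_eq_0)
      then show ?thesis by simp
    qed
  qed simp
  then show ?case by (simp only: qbin_absorb_both_aux[OF Suc.IH])
qed

lemmas qbin_absorb_both = qbin_absorb_both_aux[OF qbin_absorb_lower]

text \<open>The second Pascal rule; it differs from the defining one exactly by
  \<open>qbin_absorb_lower\<close>.\<close>

lemma qbin_Suc_Suc': "qbin q (Suc n) (Suc k) = q ^ (n - k) * qbin q n k + qbin q n (Suc k)"
  using qbin_absorb_lower[of q k n] by (simp add: algebra_simps)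

lemma qbin_mult_qpoch: "qbin q (a + b) a * (qpoch q a * qpoch q b) = qpoch q (a + b)"
proof (induction a)
  case 0
  show ?case by (simp add: qpoch_def)
next
  case (Suc a)
  have "qbin q (Suc a + b) (Suc a) * (qpoch q (Suc a) * qpoch q b)
      = (1 - q ^ Suc a) * qbin q (Suc (a + b)) (Suc a) * (qpoch q a * qpoch q b)"
    by (simp only: qpoch_Suc add_Suc mult_ac)
  also have "\<dots> = (1 - q ^ Suc (a + b)) * (qbin q (a + b) a * (qpoch q a * qpoch q b))"
    unfolding qbin_absorb_both by (simp only: mult_ac)
  finally show ?case by (simp only: Suc.IH qpoch_Suc add_Suc)
qed

section \<open>Factorization of q-multinomials\<close>

text \<open>The evaluation homomorphism inside \<open>qmultinomial\<close>. It carries identities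
  from the integer polynomials, where \<open>qpoch\<close> can be cancelled, to an arbitrary
  ring.\<close>

definition int_poly_eval :: "'a::comm_ring_1 \<Rightarrow> int poly \<Rightarrow> 'a" where
  "int_poly_eval q p = poly (map_poly of_int p) q"

lemma int_poly_eval_add: "int_poly_eval q (p + r) = int_poly_eval q p + int_poly_eval q r"
proof -
  have "map_poly (of_int :: int \<Rightarrow> 'a) (p + r) = map_poly of_int p + map_poly of_int r"
    by (rule poly_eqI) (simp add: coeff_map_poly)
  then show ?thesis by (simp add: int_poly_eval_def)
qed

lemma int_poly_eval_mult: "int_poly_eval q (p * r) = int_poly_eval q p * int_poly_eval q r"
proof -
  have "map_poly (of_int :: int \<Rightarrow> 'a) (p * r) = map_poly of_int p * map_poly of_int r"
    by (rule poly_eqI) (simp add: coeff_map_poly coeff_mult)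
  then show ?thesis by (simp add: int_poly_eval_def)
qed

lemma int_poly_eval_1: "int_poly_eval q 1 = 1"
  by (simp add: int_poly_eval_def)

lemma int_poly_eval_power_X: "int_poly_eval q ([:0, 1:] ^ n) = q ^ n"
proof (induction n)
  case (Suc n)
  have "int_poly_eval q [:0, 1:] = q" by (simp add: int_poly_eval_def map_poly_pCons)
  with Suc show ?case by (simp only: power_Suc int_poly_eval_mult)
qed (simp add: int_poly_eval_1)

lemma int_poly_eval_qbin: "int_poly_eval q (qbin [:0, 1:] n k) = qbin q n k"
  by (induction q n k rule: qbin.induct)
    (simp_all only: qbin.simps int_poly_eval_add int_poly_eval_mult int_poly_eval_1
      int_poly_eval_power_X, simp add: int_poly_eval_def)

text \<open>Each factor 1 - X^(n+1) has value 1 at 0.\<close>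

lemma qpoch_X_neq_0: "qpoch [:0, 1:] n \<noteq> (0 :: int poly)"
proof (induction n)
  case (Suc n)
  have "poly (1 - [:0, 1:] ^ Suc n) (0::int) = 1" by simp
  then have "1 - [:0, 1:] ^ Suc n \<noteq> (0 :: int poly)" by (metis poly_0 zero_neq_one)
  with Suc show ?case by (simp only: qpoch_Suc) (simp del: power_Suc)
qed (simp add: qpoch_def)

text \<open>The division is exact in the integer polynomials, and only the quotient is evaluated.
  Iteration writes a multinomial as a product of Gaussian binomials.\<close>

lemma qmultinomial_Cons:
  assumes "N = a + sum_list ns"
  shows "qmultinomial q N (a # ns) = qbin q N a * qmultinomial q (sum_list ns) ns"
proof -
  let ?X = "[:0, 1:] :: int poly"
  let ?D = "prod_list (map (qpoch ?X) ns)"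
  \<comment> \<open>\<open>E\<close> is the multinomial of the remaining entries before
    evaluation.\<close>
  obtain E where E: "qpoch ?X (sum_list ns) = ?D * E"
    using prod_list_qpoch_dvd by (metis dvd_def)
  have D: "?D \<noteq> 0" by (induction ns) (auto simp: qpoch_X_neq_0)
  have "qpoch ?X N = qbin ?X N a * (qpoch ?X a * (?D * E))"
    unfolding E[symmetric] assms by (rule qbin_mult_qpoch[symmetric])
  then have "qpoch ?X N = (qpoch ?X a * ?D) * (qbin ?X N a * E)"
    by (simp only: mult_ac)
  then have "qpoch ?X N div (qpoch ?X a * ?D) = qbin ?X N a * E"
    using D qpoch_X_neq_0[of a] by (metis mult_eq_0_iff nonzero_mult_div_cancel_left)
  moreover have "qpoch ?X (sum_list ns) div ?D = E"
    unfolding E using D by simp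
  ultimately have "qmultinomial q N (a # ns) = int_poly_eval q (qbin ?X N a * E)"
    and "qmultinomial q (sum_list ns) ns = int_poly_eval q E"
    by (simp_all add: qmultinomial_def int_poly_eval_def)
  then show ?thesis by (simp only: int_poly_eval_mult int_poly_eval_qbin)
qed

lemma qmultinomial_Nil: "qmultinomial q 0 [] = 1"
  by (simp add: qmultinomial_def qpoch_def)

text \<open>Both sides are the trinomial with lower entries i, j and n - i - j, whose denominator is
  symmetric; for i + j > n both vanish.\<close>

lemma qbin_mult_qbin_sym: "qbin q n i * qbin q (n - i) j = qbin q n j * qbin q (n - j) i"
proof (cases "i + j \<le> n")
  case True
  define m where "m = n - i - j"
  have *: "qmultinomial q n [i, j, m] = qbin q n i * qbin q (n - i) j" if "n = i + (j + m)" for i j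
    using that by (simp add: qmultinomial_Cons qmultinomial_Nil qbin_self)
  have "qmultinomial q n [i, j, m] = qmultinomial q n [j, i, m]"
    by (simp add: qmultinomial_def mult.left_commute)
  then show ?thesis using True *[of i j] *[of j i] by (simp add: m_def)
next
  case False
  then show ?thesis
    by (cases "i \<le> n"; cases "j \<le> n") (simp_all add: qbin_eq_0)
qed


section \<open>Rogers-Szego polynomials\<close>

text \<open>Absorption trades the power q^(k+1) of the Pascal rule for q^(n+1). As this is
  independent of k, summation against powers of x gives a recurrence at the same x.\<close>

lemma qbin_three_term:
  "qbin q (Suc (Suc n)) (Suc k)
    = qbin q (Suc n) (Suc k) + qbin q (Suc n) k - (1 - q ^ Suc n) * qbin q n k"
  unfolding qbin_absorb_both[symmetric] qbin.simps(3)[of q "Suc n"] by (simp add: algebra_simps)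

definition rogers_szego :: "'a::comm_ring_1 \<Rightarrow> nat \<Rightarrow> 'a \<Rightarrow> 'a" where
  "rogers_szego q n x = (\<Sum>k\<le>n. qbin q n k * x ^ k)"

lemma rogers_szego_bound:
  "n \<le> m \<Longrightarrow> rogers_szego q n x = (\<Sum>k\<le>m. qbin q n k * x ^ k)"
  unfolding rogers_szego_def by (rule sum.mono_neutral_left) (auto simp: qbin_eq_0)

lemma rogers_szego_Suc_Suc:
  "rogers_szego q (Suc (Suc n)) x
    = (1 + x) * rogers_szego q (Suc n) x - (1 - q ^ Suc n) * x * rogers_szego q n x"
proof -
  have "rogers_szego q (Suc (Suc n)) x = 1 + (\<Sum>k\<le>Suc n. qbin q (Suc (Suc n)) (Suc k) * x ^ Suc k)"
    unfolding rogers_szego_def by (subst sum.atMost_Suc_shift) simp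
  also have "\<dots> = 1 + (\<Sum>k\<le>Suc n. qbin q (Suc n) (Suc k) * x ^ Suc k)
      + x * (\<Sum>k\<le>Suc n. qbin q (Suc n) k * x ^ k)
      - (1 - q ^ Suc n) * x * (\<Sum>k\<le>Suc n. qbin q n k * x ^ k)"
    unfolding qbin_three_term
    by (simp only: ring_distribs sum.distrib sum_subtractf sum_distrib_left power_Suc mult_ac add_ac
        add_diff_eq)
  also have "1 + (\<Sum>k\<le>Suc n. qbin q (Suc n) (Suc k) * x ^ Suc k)
      = (\<Sum>k\<le>Suc (Suc n). qbin q (Suc n) k * x ^ k)"
    by (subst (2) sum.atMost_Suc_shift) simp
  also have "(\<Sum>k\<le>Suc n. qbin q n k * x ^ k) = rogers_szego q n x"
    by (rule rogers_szego_bound[symmetric]) simp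
  also have "(\<Sum>k\<le>Suc (Suc n). qbin q (Suc n) k * x ^ k) = rogers_szego q (Suc n) x"
    by (rule rogers_szego_bound[symmetric]) simp
  finally show ?thesis by (simp add: rogers_szego_def algebra_simps)
qed

text \<open>At \<open>x = c\<close>, \<open>q = c\<^sup>2\<close> the three-term recurrence factors because \<open>1 - q\<^sup>n = (1 - c\<^sup>n) (1 + c\<^sup>n)\<close>.\<close>

lemma rogers_szego_square:
  "rogers_szego (c ^ 2) (Suc n) c = (1 + c ^ Suc n) * rogers_szego (c ^ 2) n c"
proof (induction n)
  case 0
  show ?case by (simp add: rogers_szego_def)
next
  case (Suc n)
  have "(1 - (c ^ 2) ^ Suc n) * rogers_szego (c ^ 2) n c
      = (1 - c ^ Suc n) * ((1 + c ^ Suc n) * rogers_szego (c ^ 2) n c)"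
    by (simp add: algebra_simps power2_eq_square power_mult_distrib)
  also have "\<dots> = (1 - c ^ Suc n) * rogers_szego (c ^ 2) (Suc n) c"
    by (simp only: Suc.IH)
  finally have "(1 - (c ^ 2) ^ Suc n) * c * rogers_szego (c ^ 2) n c
      = c * ((1 - c ^ Suc n) * rogers_szego (c ^ 2) (Suc n) c)"
    by (simp only: mult_ac)
  then show ?case
    unfolding rogers_szego_Suc_Suc by (simp add: algebra_simps)
qed

section \<open>Recurrences for the multinomial sums\<close>

text \<open>The coefficient of \<open>x\<^sup>i y\<^sup>j\<close> in \<open>quad_poly\<close> below, up to the power of \<open>c\<close>: the factor \<open>rogers_szego\<close> is the sum over \<open>k\<close>.\<close>

definition quad_coeff :: "'a::comm_ring_1 \<Rightarrow> nat \<Rightarrow> nat \<Rightarrow> nat \<Rightarrow> 'a" where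
  "quad_coeff c n i j =
     qbin (c ^ 2) n i * qbin (c ^ 2) (n - i) j * rogers_szego (c ^ 2) (n - i - j) c"

lemma quad_coeff_eq_0: "n < i + j \<Longrightarrow> quad_coeff c n i j = 0"
  by (cases "n < i") (simp_all add: quad_coeff_def qbin_eq_0)

lemma quad_coeff_sym: "quad_coeff c n i j = quad_coeff c n j i"
  unfolding quad_coeff_def qbin_mult_qbin_sym[of _ n i j] by (simp add: add.commute)

text \<open>Absorption in base c^2 produces 1 - c^(2m) = (1 - c^m)(1 + c^m), and the second factor
  raises the index of \<open>rogers_szego\<close> from m - 1 to m. For m = 0 both sides
  vanish.\<close>

lemma quad_coeff_absorb:
  assumes "n = i + j + m"
  shows "(1 - c ^ (2 * Suc j)) * quad_coeff c n i (Suc j) = (1 - c ^ m) * quad_coeff c n i j"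
proof -
  have n: "n - i - j = m" "n - i - Suc j = m - 1" using assms by auto
  have "(1 - c ^ (2 * Suc j)) * quad_coeff c n i (Suc j)
      = qbin (c ^ 2) n i * ((1 - (c ^ 2) ^ Suc j) * qbin (c ^ 2) (n - i) (Suc j))
          * rogers_szego (c ^ 2) (m - 1) c"
    unfolding quad_coeff_def n power_mult by (simp only: mult_ac)
  also have "\<dots> = qbin (c ^ 2) n i * qbin (c ^ 2) (n - i) j
      * ((1 - c ^ (2 * m)) * rogers_szego (c ^ 2) (m - 1) c)"
    unfolding qbin_absorb_lower n power_mult by (simp only: mult_ac)
  also have "(1 - c ^ (2 * m)) * rogers_szego (c ^ 2) (m - 1) c
      = (1 - c ^ m) * rogers_szego (c ^ 2) m c"
  proof (cases m)
    case (Suc m')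
    have "c ^ (2 * m) = c ^ m * c ^ m" by (simp add: mult_2 power_add)
    then show ?thesis
      by (simp add: Suc rogers_szego_square algebra_simps)
  qed simp
  finally show ?thesis unfolding quad_coeff_def n by (simp only: mult_ac)
qed

text \<open>The Pascal rule for trinomials, from the second binomial Pascal rule applied to each
  factor. The conditionals stand for terms of index -1.\<close>

lemma qbin_mult_qbin_Suc:
  assumes "Suc n = i + j + m"
  shows "qbin q (Suc n) i * qbin q (Suc n - i) j = qbin q n i * qbin q (n - i) j
    + (if j = 0 then 0 else q ^ m * (qbin q n i * qbin q (n - i) (j - 1)))
    + (if i = 0 then 0 else q ^ (m + j) * (qbin q n (i - 1) * qbin q (n - (i - 1)) j))"
proof -
  have 1: "qbin q (Suc n) i
      = qbin q n i + (if i = 0 then 0 else q ^ (m + j) * qbin q n (i - 1))"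
    using assms by (cases i) (simp_all add: qbin_Suc_Suc' add.commute del: qbin.simps(3))
  have 2: "qbin q n i * qbin q (Suc n - i) j = qbin q n i * qbin q (n - i) j
    + (if j = 0 then 0 else q ^ m * (qbin q n i * qbin q (n - i) (j - 1)))"
  proof (cases "i \<le> n")
    case True
    then have "Suc n - i = Suc (n - i)" by simp
    moreover have "n - i - j' = m" if "j = Suc j'" for j' using that assms by simp
    ultimately have "qbin q (Suc n - i) j
        = qbin q (n - i) j + (if j = 0 then 0 else q ^ m * qbin q (n - i) (j - 1))"
      by (cases j) (simp_all only: qbin_Suc_Suc', simp_all)
    then show ?thesis by (simp add: algebra_simps)
  qed (simp add: qbin_eq_0)
  have "qbin q (Suc n) i * qbin q (Suc n - i) j = qbin q n i * qbin q (Suc n - i) j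
      + (if i = 0 then 0 else q ^ (m + j) * (qbin q n (i - 1) * qbin q (Suc n - i) j))"
    unfolding 1 by (simp add: algebra_simps)
  moreover have "i \<noteq> 0 \<Longrightarrow> Suc n - i = n - (i - 1)" by simp
  ultimately show ?thesis unfolding 2 by auto
qed

text \<open>The trinomial Pascal rule, with its powers of c rearranged by
  \<open>quad_coeff_absorb\<close> into the form that \<open>quad_poly_Suc\<close> needs.\<close>

lemma quad_coeff_Suc:
  assumes "Suc n = i + j + m"
  shows "quad_coeff c (Suc n) i j = (1 + c ^ (m + 2 * j)) * quad_coeff c n i j
    + (if j = 0 then 0 else c ^ m * quad_coeff c n i (j - 1))
    + (if i = 0 then 0 else c ^ (2 * m + 2 * j) * quad_coeff c n (i - 1) j)"
proof -
  define R where "R = rogers_szego (c ^ 2) m c"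
  have "Suc n - i - j = m" using assms by simp
  then have "quad_coeff c (Suc n) i j = qbin (c ^ 2) (Suc n) i * qbin (c ^ 2) (Suc n - i) j * R"
    by (simp only: quad_coeff_def R_def)
  also have "\<dots> = qbin (c ^ 2) n i * qbin (c ^ 2) (n - i) j * R
    + (if j = 0 then 0 else c ^ (2 * m) * (qbin (c ^ 2) n i * qbin (c ^ 2) (n - i) (j - 1) * R))
    + (if i = 0 then 0 else c ^ (2 * m + 2 * j)
        * (qbin (c ^ 2) n (i - 1) * qbin (c ^ 2) (n - (i - 1)) j * R))"
    unfolding qbin_mult_qbin_Suc[OF assms] by (simp add: algebra_simps power_add flip: power_mult)
  \<comment> \<open>Here \<open>R\<close> has index m while \<open>quad_coeff c n i j\<close>
    contains index m - 1; the missing factor is 1 + c^m.\<close>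
  also have "qbin (c ^ 2) n i * qbin (c ^ 2) (n - i) j * R = (1 + c ^ m) * quad_coeff c n i j"
  proof (cases m)
    case 0
    then have *: "n < i + j" using assms by simp
    then have "qbin (c ^ 2) n i * qbin (c ^ 2) (n - i) j = 0"
      by (cases "n < i") (simp_all add: qbin_eq_0)
    then show ?thesis by (simp add: quad_coeff_eq_0[OF *])
  next
    case (Suc m')
    then have "n - i - j = m'" using assms by simp
    then show ?thesis
      unfolding quad_coeff_def R_def Suc rogers_szego_square by (simp only: mult_ac)
  qed
  also have "(if j = 0 then 0 else c ^ (2 * m) * (qbin (c ^ 2) n i * qbin (c ^ 2) (n - i) (j - 1) * R))
      = (if j = 0 then 0 else c ^ (2 * m) * quad_coeff c n i (j - 1))"
    using assms by (auto simp: quad_coeff_def R_def)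
  also have "(if i = 0 then 0 else c ^ (2 * m + 2 * j)
        * (qbin (c ^ 2) n (i - 1) * qbin (c ^ 2) (n - (i - 1)) j * R))
      = (if i = 0 then 0 else c ^ (2 * m + 2 * j) * quad_coeff c n (i - 1) j)"
  proof -
    have "i \<noteq> 0 \<Longrightarrow> n - (i - 1) - j = m" using assms by simp
    then show ?thesis by (simp add: quad_coeff_def R_def)
  qed
  \<comment> \<open>The two sides differ by c^m times the absorption identity between j and j -
    1.\<close>
  also have "(1 + c ^ m) * quad_coeff c n i j
      + (if j = 0 then 0 else c ^ (2 * m) * quad_coeff c n i (j - 1))
    = (1 + c ^ (m + 2 * j)) * quad_coeff c n i j
      + (if j = 0 then 0 else c ^ m * quad_coeff c n i (j - 1))"
  proof (cases j)
    case (Suc j')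
    have "c ^ m * ((1 - c ^ (2 * j)) * quad_coeff c n i j)
        = c ^ m * ((1 - c ^ m) * quad_coeff c n i j')"
      using quad_coeff_absorb[of n i j' m c] assms Suc by simp
    moreover have "c ^ (2 * m) = c ^ m * c ^ m" "c ^ (m + 2 * j) = c ^ m * c ^ (2 * j)"
      by (simp_all add: mult_2 power_add)
    ultimately show ?thesis by (simp add: Suc algebra_simps)
  qed simp
  finally show ?thesis .
qed

section \<open>The symmetric quadrinomial sum and its two functional equations\<close>

text \<open>The weight c^(i(i-1)) is the base c^2 raised to i choose 2. Truncation of i - 1 at i = 0
  is harmless because of the factor i.\<close>

definition quad_poly :: "'a::comm_ring_1 \<Rightarrow> nat \<Rightarrow> 'a \<Rightarrow> 'a \<Rightarrow> 'a" where
  "quad_poly c N x y = (\<Sum>(i, j, k, l)\<in>quads N. qmultinomial (c ^ 2) N [i, j, k, l] *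
     (c ^ (i * (i - 1)) * x ^ i) * (c ^ (j * (j - 1)) * y ^ j) * c ^ k)"

text \<open>The index l is determined by the others, and the sum over k is the factor
  \<open>rogers_szego\<close>. Padding with vanishing terms up to M lets sums of index n and n + 1
  share one range.\<close>

lemma quad_poly_eq:
  assumes "N \<le> M"
  shows "quad_poly c N x y = (\<Sum>i\<le>M. \<Sum>j\<le>M.
    quad_coeff c N i j * (c ^ (i * (i - 1)) * x ^ i) * (c ^ (j * (j - 1)) * y ^ j))"
proof -
  let ?X = "\<lambda>i. c ^ (i * (i - 1)) * x ^ i" and ?Y = "\<lambda>j. c ^ (j * (j - 1)) * y ^ j"
  let ?b = "\<lambda>i j k. qbin (c ^ 2) N i * qbin (c ^ 2) (N - i) j * qbin (c ^ 2) (N - i - j) k"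
  have qm: "qmultinomial (c ^ 2) N [i, j, k, l] = ?b i j k" if "i + j + k + l = N" for i j k l
  proof -
    have "N = i + (j + (k + l))" using that by simp
    then show ?thesis by (simp add: qmultinomial_Cons qmultinomial_Nil qbin_self)
  qed
  have "quad_poly c N x y = (\<Sum>(i, j, k, l)\<in>quads N. ?b i j k * ?X i * ?Y j * c ^ k)"
    unfolding quad_poly_def
  proof (intro sum.cong refl)
    fix z assume "z \<in> quads N"
    moreover obtain i j k l where z: "z = (i, j, k, l)" using prod_cases4 by blast
    ultimately have "i + j + k + l = N" by (simp add: quads_def)
    then show "(case z of (i, j, k, l) \<Rightarrow> qmultinomial (c ^ 2) N [i, j, k, l] * ?X i * ?Y j * c ^ k)
        = (case z of (i, j, k, l) \<Rightarrow> ?b i j k * ?X i * ?Y j * c ^ k)"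
      by (simp only: z prod.case qm)
  qed
  also have "\<dots> = (\<Sum>(i, j, k)\<in>{(i, j, k). i + j + k \<le> N}. ?b i j k * ?X i * ?Y j * c ^ k)"
    by (rule sum.reindex_bij_witness[of _ "\<lambda>(i, j, k). (i, j, k, N - i - j - k)"
          "\<lambda>(i, j, k, l). (i, j, k)"]) (auto simp: quads_def)
  also have "\<dots> = (\<Sum>(i, j, k)\<in>{..M} \<times> {..M} \<times> {..M}. ?b i j k * ?X i * ?Y j * c ^ k)"
  proof (rule sum.mono_neutral_left)
    have "?b i j k * ?X i * ?Y j * c ^ k = 0" if "\<not> i + j + k \<le> N" for i j k
      using that by (cases "i \<le> N"; cases "i + j \<le> N") (simp_all add: qbin_eq_0)
    then show "\<forall>z\<in>{..M} \<times> {..M} \<times> {..M} - {(i, j, k). i + j + k \<le> N}.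
        (case z of (i, j, k) \<Rightarrow> ?b i j k * ?X i * ?Y j * c ^ k) = 0"
      by auto
  qed (use assms in auto)
  also have "\<dots> = (\<Sum>i\<le>M. \<Sum>j\<le>M. \<Sum>k\<le>M. ?b i j k * ?X i * ?Y j * c ^ k)"
    by (simp add: sum.cartesian_product)
  also have "\<dots> = (\<Sum>i\<le>M. \<Sum>j\<le>M. quad_coeff c N i j * ?X i * ?Y j)"
  proof (intro sum.cong refl)
    fix i j
    have "N - i - j \<le> M" using assms by simp
    then show "(\<Sum>k\<le>M. ?b i j k * ?X i * ?Y j * c ^ k) = quad_coeff c N i j * ?X i * ?Y j"
      unfolding quad_coeff_def rogers_szego_bound[OF \<open>N - i - j \<le> M\<close>] sum_distrib_left
        sum_distrib_right
      by (intro sum.cong refl) (simp only: mult_ac)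
  qed
  finally show ?thesis .
qed

lemma quad_poly_sym: "quad_poly c N x y = quad_poly c N y x"
  unfolding quad_poly_eq[OF order_refl]
  by (subst sum.swap) (simp only: quad_coeff_sym[of c N] mult_ac)

lemma quad_poly_0: "quad_poly c 0 x y = 1"
  by (simp add: quad_poly_eq[OF order_refl] quad_coeff_def rogers_szego_def)

lemma power_triangle_Suc:
  fixes c :: "'a::monoid_mult"
  shows "c ^ (Suc i * i) = c ^ i * c ^ i * c ^ (i * (i - 1))"
proof -
  have "Suc i * i = i + i + i * (i - 1)" by (cases i) auto
  then show ?thesis by (simp only: power_add)
qed

text \<open>The vanishing top term allows an index shift that keeps the range, so that shifted and
  unshifted sums can be compared termwise.\<close>

lemma sum_atMost_shift:
  fixes f :: "nat \<Rightarrow> 'a::comm_monoid_add"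
  assumes "f (Suc n) = 0"
  shows "(\<Sum>i\<le>Suc n. f i) = (\<Sum>i\<le>Suc n. if i = 0 then 0 else f (i - 1))"
  by (subst sum.atMost_Suc_shift) (simp add: assms)

lemma quad_poly_Suc:
  "quad_poly c (Suc n) (c * x) y
    = (1 + c ^ (2 * n + 1) * x) * quad_poly c n (c * x) y + c ^ n * (y + c) * quad_poly c n x (c * y)"
proof -
  let ?X = "\<lambda>i. c ^ (i * (i - 1)) * x ^ i" and ?Y = "\<lambda>j. c ^ (j * (j - 1)) * y ^ j"
  let ?a = "\<lambda>i j. quad_coeff c n i j * ?X i * ?Y j"
  let ?M = "{..Suc n}"
  have cx: "quad_poly c m (c * x) y
      = (\<Sum>i\<in>?M. \<Sum>j\<in>?M. c ^ i * (quad_coeff c m i j * ?X i * ?Y j))" if "m \<le> Suc n" for m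
    unfolding quad_poly_eq[OF that] by (simp only: power_mult_distrib mult_ac)
  have cy: "quad_poly c n x (c * y) = (\<Sum>i\<in>?M. \<Sum>j\<in>?M. c ^ j * ?a i j)"
    unfolding quad_poly_eq[OF le_SucI[OF order_refl]] by (simp only: power_mult_distrib mult_ac)
  have shift_x: "(\<Sum>i\<in>?M. \<Sum>j\<in>?M. c ^ i * ?a i j)
      = (\<Sum>i\<in>?M. \<Sum>j\<in>?M. if i = 0 then 0 else c ^ (i - 1) * ?a (i - 1) j)"
    by (subst sum_atMost_shift) (auto simp: quad_coeff_eq_0 intro!: sum.cong)
  have shift_y: "(\<Sum>i\<in>?M. \<Sum>j\<in>?M. c ^ j * ?a i j)
      = (\<Sum>i\<in>?M. \<Sum>j\<in>?M. if j = 0 then 0 else c ^ (j - 1) * ?a i (j - 1))"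
    by (intro sum.cong refl sum_atMost_shift) (simp add: quad_coeff_eq_0)
  \<comment> \<open>This is \<open>quad_coeff_Suc\<close> with m = n + 1 - i - j, times c^i and the
    weights in x and y. Its factor 1 + c^(m+2j) gives the first two terms, since i + m + 2j = n + 1
    + j.\<close>
  have term_eq: "c ^ i * (quad_coeff c (Suc n) i j * ?X i * ?Y j)
      = c ^ i * ?a i j + c ^ Suc n * (c ^ j * ?a i j)
        + c ^ (2 * n + 1) * x * (if i = 0 then 0 else c ^ (i - 1) * ?a (i - 1) j)
        + c ^ n * y * (if j = 0 then 0 else c ^ (j - 1) * ?a i (j - 1))" for i j
  proof (cases "i + j \<le> Suc n")
    case True
    then obtain m where n: "Suc n = i + j + m" by (metis le_iff_add)
    have 1: "c ^ (2 * n + 1) * x * (if i = 0 then 0 else c ^ (i - 1) * ?a (i - 1) j)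
        = c ^ i * ((if i = 0 then 0 else c ^ (2 * m + 2 * j) * quad_coeff c n (i - 1) j) * ?X i * ?Y j)"
    proof (cases i)
      case i: (Suc i')
      have "n = i' + j + m" using n i by simp
      then have "c ^ (2 * n + 1) * c ^ i' = c ^ i * c ^ (2 * m + 2 * j) * (c ^ i' * c ^ i')"
        by (simp add: i algebra_simps flip: power_add power_Suc)
      then have "x * ?a i' j * (c ^ (2 * n + 1) * c ^ i')
          = x * ?a i' j * (c ^ i * c ^ (2 * m + 2 * j) * (c ^ i' * c ^ i'))" by simp
      then show ?thesis
        unfolding i diff_Suc_1 power_triangle_Suc by (simp only: power_Suc nat.distinct if_False mult_ac)
    qed simp
    have 2: "c ^ n * y * (if j = 0 then 0 else c ^ (j - 1) * ?a i (j - 1))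
        = c ^ i * ((if j = 0 then 0 else c ^ m * quad_coeff c n i (j - 1)) * ?X i * ?Y j)"
    proof (cases j)
      case j: (Suc j')
      have "n = i + j' + m" using n j by simp
      then have "c ^ n * c ^ j' = c ^ i * c ^ m * (c ^ j' * c ^ j')"
        by (simp add: algebra_simps flip: power_add)
      then have "y * ?a i j' * (c ^ n * c ^ j')
          = y * ?a i j' * (c ^ i * c ^ m * (c ^ j' * c ^ j'))" by simp
      then show ?thesis
        unfolding j diff_Suc_1 power_triangle_Suc by (simp only: power_Suc nat.distinct if_False mult_ac)
    qed simp
    have 3: "c ^ Suc n * (c ^ j * ?a i j) = c ^ i * (c ^ (m + 2 * j) * ?a i j)"
      unfolding n mult_2 power_add by (simp only: mult_ac)
    show ?thesis
      unfolding quad_coeff_Suc[OF n] 1 2 3 by (simp only: ring_distribs mult_1_left mult_ac add_ac)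
  next
    case False
    then show ?thesis by (simp add: quad_coeff_eq_0)
  qed
  have "quad_poly c (Suc n) (c * x) y
      = (\<Sum>i\<in>?M. \<Sum>j\<in>?M. c ^ i * ?a i j) + c ^ Suc n * (\<Sum>i\<in>?M. \<Sum>j\<in>?M. c ^ j * ?a i j)
        + c ^ (2 * n + 1) * x
          * (\<Sum>i\<in>?M. \<Sum>j\<in>?M. if i = 0 then 0 else c ^ (i - 1) * ?a (i - 1) j)
        + c ^ n * y * (\<Sum>i\<in>?M. \<Sum>j\<in>?M. if j = 0 then 0 else c ^ (j - 1) * ?a i (j - 1))"
    unfolding cx[OF order_refl] term_eq by (simp only: sum.distrib sum_distrib_left)
  also have "\<dots> = quad_poly c n (c * x) y + c ^ Suc n * quad_poly c n x (c * y)
        + c ^ (2 * n + 1) * x * quad_poly c n (c * x) y + c ^ n * y * quad_poly c n x (c * y)"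
    unfolding shift_x[symmetric] shift_y[symmetric] cx[OF le_SucI[OF order_refl]] cy by (rule refl)
  finally show ?thesis by (simp add: algebra_simps)
qed

text \<open>Multiplication by x shifts i by one, and \<open>quad_coeff_absorb\<close>, moved to the
  first index by symmetry, relates the coefficients at i and i - 1.\<close>

lemma quad_poly_scale:
  "(1 + x) * quad_poly c n (c ^ 2 * x) (c * y)
    = quad_poly c n x (c * y) + x * c ^ n * quad_poly c n (c * x) y"
proof -
  let ?X = "\<lambda>i. c ^ (i * (i - 1)) * x ^ i" and ?Y = "\<lambda>j. c ^ (j * (j - 1)) * y ^ j"
  let ?a = "\<lambda>i j. quad_coeff c n i j * ?X i * ?Y j"
  let ?M = "{..Suc n}"
  note expand = quad_poly_eq[OF le_SucI[OF order_refl]]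
  have e1: "quad_poly c n (c ^ 2 * x) (c * y)
      = (\<Sum>i\<in>?M. \<Sum>j\<in>?M. c ^ (2 * i) * c ^ j * ?a i j)"
    unfolding expand by (simp only: power_mult_distrib power_mult[symmetric] mult_ac)
  have e2: "quad_poly c n x (c * y) = (\<Sum>i\<in>?M. \<Sum>j\<in>?M. c ^ j * ?a i j)"
    unfolding expand by (simp only: power_mult_distrib mult_ac)
  have e3: "quad_poly c n (c * x) y = (\<Sum>i\<in>?M. \<Sum>j\<in>?M. c ^ i * ?a i j)"
    unfolding expand by (simp only: power_mult_distrib mult_ac)
  have shift: "(\<Sum>i\<in>?M. \<Sum>j\<in>?M. g i j * ?a i j)
      = (\<Sum>i\<in>?M. \<Sum>j\<in>?M. if i = 0 then 0 else g (i - 1) j * ?a (i - 1) j)" for g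
    by (subst sum_atMost_shift) (auto simp: quad_coeff_eq_0 intro!: sum.cong)
  have term_eq: "c ^ (2 * i) * c ^ j * ?a i j
        + x * (if i = 0 then 0 else c ^ (2 * (i - 1)) * c ^ j * ?a (i - 1) j)
      = c ^ j * ?a i j + x * c ^ n * (if i = 0 then 0 else c ^ (i - 1) * ?a (i - 1) j)" for i j
  proof (cases "i = 0 \<or> n < i - 1 + j")
    case True
    then show ?thesis by (auto simp: quad_coeff_eq_0)
  next
    case False
    then obtain i' where i: "i = Suc i'" by (metis not0_implies_Suc)
    have "n \<ge> i' + j" using False i by simp
    then obtain m where n: "n = j + i' + m" by (metis add.commute le_iff_add)
    have abs: "quad_coeff c n i j
        = c ^ (2 * i) * quad_coeff c n i j + quad_coeff c n i' j - c ^ m * quad_coeff c n i' j"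
      using quad_coeff_absorb[OF n, of c]
      unfolding i quad_coeff_sym[of c n j] by (simp add: algebra_simps)
    have "x * (c ^ (2 * i') * c ^ j * ?a i' j) = c ^ j * (quad_coeff c n i' j * ?X i * ?Y j)"
      unfolding i diff_Suc_1 power_triangle_Suc mult_2 power_add by (simp only: power_Suc mult_ac)
    moreover have "x * c ^ n * (c ^ i' * ?a i' j)
        = c ^ j * (c ^ m * quad_coeff c n i' j * ?X i * ?Y j)"
      unfolding i diff_Suc_1 power_triangle_Suc n by (simp add: power_add mult_ac)
    moreover have "c ^ j * ?a i j = c ^ (2 * i) * c ^ j * ?a i j
        + c ^ j * (quad_coeff c n i' j * ?X i * ?Y j)
        - c ^ j * (c ^ m * quad_coeff c n i' j * ?X i * ?Y j)"
      by (subst abs) (simp add: algebra_simps)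
    ultimately show ?thesis unfolding i by simp
  qed
  have "(1 + x) * quad_poly c n (c ^ 2 * x) (c * y)
      = (\<Sum>i\<in>?M. \<Sum>j\<in>?M. c ^ (2 * i) * c ^ j * ?a i j)
        + x * (\<Sum>i\<in>?M. \<Sum>j\<in>?M. c ^ (2 * i) * c ^ j * ?a i j)"
    unfolding e1 by (simp add: algebra_simps)
  also have "\<dots> = (\<Sum>i\<in>?M. \<Sum>j\<in>?M. c ^ (2 * i) * c ^ j * ?a i j
        + x * (if i = 0 then 0 else c ^ (2 * (i - 1)) * c ^ j * ?a (i - 1) j))"
    unfolding sum.distrib sum_distrib_left[symmetric] shift[of "\<lambda>i j. c ^ (2 * i) * c ^ j", symmetric]
    by (rule refl)
  also have "\<dots> = quad_poly c n x (c * y) + x * c ^ n * quad_poly c n (c * x) y"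
    unfolding term_eq e2 e3 shift[of "\<lambda>i j. c ^ i"]
    by (simp only: sum.distrib sum_distrib_left)
  finally show ?thesis .
qed

section \<open>Recurrences for the partition polynomials\<close>

lemma odd_idx_Cons: "odd_idx i (a # \<pi>) = (if a mod 3 = i then 1 else 0) + even_idx i \<pi>"
proof -
  have "{k. k < length (a # \<pi>) \<and> even k \<and> (a # \<pi>) ! k mod 3 = i}
      = (if a mod 3 = i then {0} else {}) \<union> Suc ` {k. k < length \<pi> \<and> odd k \<and> \<pi> ! k mod 3 = i}"
    by (rule set_eqI, case_tac x) (auto simp: image_iff)
  then show ?thesis
    unfolding odd_idx_def even_idx_def by (simp add: card_Un_disjoint card_image)
qed

lemma even_idx_Cons: "even_idx i (a # \<pi>) = odd_idx i \<pi>"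
proof -
  have "{k. k < length (a # \<pi>) \<and> odd k \<and> (a # \<pi>) ! k mod 3 = i}
      = Suc ` {k. k < length \<pi> \<and> even k \<and> \<pi> ! k mod 3 = i}"
    by (rule set_eqI, case_tac x) (auto simp: image_iff)
  then show ?thesis
    unfolding odd_idx_def even_idx_def by (simp add: card_image)
qed

lemma P_0: "P 0 s t u v q = 1"
proof -
  have "\<pi> = []" if "\<pi> \<in> DS3 0" for \<pi>
    using that by (cases \<pi>) (auto simp: DS3_def)
  moreover have "[] \<in> DS3 0" by (simp add: DS3_def)
  ultimately have "DS3 0 = {[]}" by blast
  then show ?thesis by (simp add: P_def odd_idx_def even_idx_def)
qed

text \<open>Partitions are split by whether M + 1 is a part. The bound \<open>K\<close> describes
  what may follow that part; prepending it swaps odd and even indices, hence the swapped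
  variables.\<close>

lemma P_Suc:
  assumes K: "\<And>\<pi>. Suc M # \<pi> \<in> DS3 (Suc M) \<longleftrightarrow> \<pi> \<in> DS3 K"
  shows "P (Suc M) s t u v q = P M s t u v q
    + (if Suc M mod 3 = 1 then s else if Suc M mod 3 = 2 then t else 1) * q ^ Suc M * P K u v s t q"
proof -
  let ?w = "\<lambda>\<pi>. s ^ odd_idx 1 \<pi> * t ^ odd_idx 2 \<pi> * u ^ even_idx 1 \<pi> * v ^ even_idx 2 \<pi>
    * q ^ sum_list \<pi>"
  have "\<pi> \<in> DS3 M \<union> (#) (Suc M) ` DS3 K" if "\<pi> \<in> DS3 (Suc M)" for \<pi>
  proof (cases \<pi>)
    case Nil
    then show ?thesis by (simp add: DS3_def)
  next
    case (Cons a \<rho>)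
    show ?thesis
    proof (cases "a = Suc M")
      case True
      then show ?thesis using that K Cons by auto
    next
      case False
      then have "\<forall>x\<in>set \<pi>. x \<le> M" using that Cons by (force simp: DS3_def)
      then show ?thesis using that by (simp add: DS3_def)
    qed
  qed
  moreover have "DS3 M \<subseteq> DS3 (Suc M)" by (auto simp: DS3_def)
  ultimately have split: "DS3 (Suc M) = DS3 M \<union> (#) (Suc M) ` DS3 K"
    using K by auto
  have "DS3 M \<inter> (#) (Suc M) ` DS3 K = {}" by (auto simp: DS3_def)
  then have "P (Suc M) s t u v q = P M s t u v q + (\<Sum>\<pi>\<in>(#) (Suc M) ` DS3 K. ?w \<pi>)"
    unfolding P_def split by (simp add: sum.union_disjoint finite_DS3)
  also have "(\<Sum>\<pi>\<in>(#) (Suc M) ` DS3 K. ?w \<pi>) = (\<Sum>\<pi>\<in>DS3 K. ?w (Suc M # \<pi>))"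
    by (subst sum.reindex) (auto simp: comp_def)
  also have "\<dots> = (if Suc M mod 3 = 1 then s else if Suc M mod 3 = 2 then t else 1) * q ^ Suc M
      * P K u v s t q"
    unfolding P_def sum_distrib_left
    by (intro sum.cong refl) (simp add: odd_idx_Cons even_idx_Cons power_add mult_ac)
  finally show ?thesis .
qed

lemma P_3n_1: "P (3 * n + 1) s t u v q = P (3 * n) s t u v q + s * q ^ (3 * n + 1) * P (3 * n) u v s t q"
proof -
  have "Suc (3 * n) # \<pi> \<in> DS3 (Suc (3 * n)) \<longleftrightarrow> \<pi> \<in> DS3 (3 * n)" for \<pi>
    unfolding DS3_def by auto presburger+
  from P_Suc[OF this] show ?thesis by simp
qed

text \<open>The part 3n + 2 excludes 3n + 1, so both leave a remainder bounded by 3n. This is why s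
  and t enter only through sq + tq^2.\<close>

lemma P_3n_2: "P (3 * n + 2) s t u v q
  = P (3 * n) s t u v q + (s * q + t * q ^ 2) * q ^ (3 * n) * P (3 * n) u v s t q"
proof -
  have "Suc (3 * n + 1) # \<pi> \<in> DS3 (Suc (3 * n + 1)) \<longleftrightarrow> \<pi> \<in> DS3 (3 * n)" for \<pi>
    unfolding DS3_def by (auto simp: less_Suc_eq_le) (metis le_SucE, presburger)
  from P_Suc[OF this] have "P (3 * n + 2) s t u v q
      = P (3 * n + 1) s t u v q + t * q ^ (3 * n + 2) * P (3 * n) u v s t q"
    by (simp add: mod_Suc)
  then show ?thesis
    unfolding P_3n_1 by (simp add: power_add power2_eq_square algebra_simps)
qed

text \<open>A multiple of 3 lies in no forbidden pair, so the remainder may use everything up to 3n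
  + 2.\<close>

lemma P_3n_3: "P (3 * Suc n) s t u v q
  = P (3 * n + 2) s t u v q + q ^ (3 * Suc n) * P (3 * n + 2) u v s t q"
proof -
  have eq: "3 * Suc n = Suc (3 * n + 2)" by simp
  have "Suc (3 * n + 2) # \<pi> \<in> DS3 (Suc (3 * n + 2)) \<longleftrightarrow> \<pi> \<in> DS3 (3 * n + 2)" for \<pi>
    unfolding DS3_def by auto presburger+
  from P_Suc[OF this] show ?thesis
    unfolding eq by (simp del: power_Suc)
qed

section \<open>Closed forms of the partition polynomials\<close>

lemma P_3n: "P (3 * n) s t u v q = quad_poly (q ^ 3) n (s * q + t * q ^ 2) (q ^ 3 * (u * q + v * q ^ 2))"
proof (induction n arbitrary: s t u v)
  case 0
  show ?case by (simp add: P_0 quad_poly_0)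
next
  case (Suc n)
  define c x y where "c = q ^ 3" and "x = s * q + t * q ^ 2" and "y = u * q + v * q ^ 2"
  have q: "q ^ (3 * m) = c ^ m" for m by (simp add: c_def power_mult)
  \<comment> \<open>The induction hypothesis at (s, t, u, v) and at (u, v, s, t), with arguments
    ordered by symmetry to fit \<open>quad_poly_Suc\<close>.\<close>
  define A B where "A = quad_poly c n (c * y) x" and "B = quad_poly c n y (c * x)"
  have "P (3 * n) s t u v q = A" "P (3 * n) u v s t q = B"
    unfolding Suc.IH A_def B_def x_def y_def c_def by (simp_all only: quad_poly_sym)
  then have "P (3 * Suc n) s t u v q = A + x * c ^ n * B + c ^ Suc n * (B + y * c ^ n * A)"
    unfolding P_3n_3 P_3n_2 q x_def y_def by simp
  also have "\<dots> = (1 + c ^ (2 * n + 1) * y) * A + c ^ n * (x + c) * B"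
    by (simp add: mult_2 mult_2_right power_add algebra_simps)
  also have "\<dots> = quad_poly c (Suc n) (c * y) x"
    unfolding A_def B_def by (rule quad_poly_Suc[symmetric])
  finally show ?case
    unfolding quad_poly_sym[of "q ^ 3" "Suc n" "s * q + t * q ^ 2"] c_def x_def y_def .
qed

text \<open>The part 3n + 1 contributes s without t, so x and y alone do not suffice here. The
  second term disappears for s = 0, which explains the two shapes of the final formulas.\<close>

lemma P_3n_1_eq:
  fixes s t u v q :: "'a::comm_ring_1"
  defines "x \<equiv> s * q + t * q ^ 2" and "y \<equiv> u * q + v * q ^ 2"
  shows "P (3 * n + 1) s t u v q = quad_poly (q ^ 3) n x (q ^ 3 * y)
    + s * q ^ (3 * n + 1) * quad_poly (q ^ 3) n y (q ^ 3 * x)"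
  unfolding P_3n_1 P_3n x_def y_def by (rule refl)

lemma P_3n_2_eq:
  fixes s t u v q :: "'a::comm_ring_1"
  defines "x \<equiv> s * q + t * q ^ 2" and "y \<equiv> u * q + v * q ^ 2"
  shows "P (3 * n + 2) s t u v q = (1 + x) * quad_poly (q ^ 3) n (q ^ 6 * x) (q ^ 3 * y)"
proof -
  have "P (3 * n + 2) s t u v q = quad_poly (q ^ 3) n x (q ^ 3 * y)
      + x * (q ^ 3) ^ n * quad_poly (q ^ 3) n (q ^ 3 * x) y"
    unfolding P_3n_2 P_3n x_def y_def power_mult quad_poly_sym[of _ _ "u * q + v * q ^ 2"]
    by (rule refl)
  also have "\<dots> = (1 + x) * quad_poly (q ^ 3) n ((q ^ 3) ^ 2 * x) (q ^ 3 * y)"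
    by (rule quad_poly_scale[symmetric])
  finally show ?thesis by (simp flip: power_mult)
qed

section \<open>Specialization to two surviving variables\<close>

lemma quad_poly_monomials:
  "quad_poly (q ^ 3) N (x * q ^ a) (y * q ^ b)
    = (\<Sum>(i, j, k, l)\<in>quads N. qmultinomial (q ^ 6) N [i, j, k, l] * x ^ i * y ^ j *
        qpow q (3 * int i ^ 2 + (int a - 3) * int i + 3 * int j ^ 2 + (int b - 3) * int j + 3 * int k))"
proof -
  \<comment> \<open>The integer exponent is the image of a natural number, so \<open>nat\<close>
    loses nothing.\<close>
  have "3 * int i ^ 2 + (int a - 3) * int i + 3 * int j ^ 2 + (int b - 3) * int j + 3 * int k
      = int (3 * (i * (i - 1)) + a * i + 3 * (j * (j - 1)) + b * j + 3 * k)" for i j k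
    by (cases i; cases j) (simp_all add: algebra_simps power2_eq_square)
  then have "qpow q (3 * int i ^ 2 + (int a - 3) * int i + 3 * int j ^ 2 + (int b - 3) * int j
        + 3 * int k)
      = (q ^ 3) ^ (i * (i - 1)) * (q ^ a) ^ i * (q ^ 3) ^ (j * (j - 1)) * (q ^ b) ^ j * (q ^ 3) ^ k"
    for i j k
    by (simp only: nat_int power_add power_mult)
  then show ?thesis
    unfolding quad_poly_def
    by (intro sum.cong refl) (auto simp: power_mult_distrib mult_ac simp flip: power_mult)
qed

text \<open>Covers all four choices of surviving variables \<open>z\<close> and \<open>w\<close>.
  \<open>Q\<close> and \<open>e\<close> are separate parameters so that the rule matches each
  formula as it is written.\<close>

lemma P_3n_mu_monomials:
  fixes s t u v q z w Q :: "'a::comm_ring_1"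
  assumes "\<mu> \<in> {0, 2}"
    and x: "s * q + t * q ^ 2 = z * q ^ a" and y: "u * q + v * q ^ 2 = w * q ^ b"
    and Q: "Q = q ^ a"
    and e: "\<And>i j k. e i j k
      = 3 * int i ^ 2 + (3 * int \<mu> + int a - 3) * int i + 3 * int j ^ 2 + int b * int j + 3 * int k"
  shows "P (3 * N + \<mu>) s t u v q = (1 + of_nat (\<mu> div 2) * z * Q) *
    (\<Sum>(i, j, k, l)\<in>quads N. qmultinomial (q ^ 6) N [i, j, k, l] * z ^ i * w ^ j * qpow q (e i j k))"
proof -
  have "P (3 * N + \<mu>) s t u v q = (1 + of_nat (\<mu> div 2) * z * q ^ a) *
      quad_poly (q ^ 3) N (z * q ^ (a + 3 * \<mu>)) (w * q ^ (b + 3))"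
  proof (cases "\<mu> = 0")
    case True
    show ?thesis unfolding True add_0_right P_3n x y by (simp add: power_add mult_ac)
  next
    case False
    then have "\<mu> = 2" using assms(1) by simp
    show ?thesis unfolding \<open>\<mu> = 2\<close> P_3n_2_eq x y by (simp add: power_add mult_ac)
  qed
  moreover have "int (a + 3 * \<mu>) - 3 = 3 * int \<mu> + int a - 3" "int (b + 3) - 3 = int b" by simp_all
  ultimately show ?thesis by (simp only: quad_poly_monomials Q e)
qed

lemma P_3n_1_monomials:
  fixes t u v q w :: "'a::comm_ring_1"
  assumes y: "u * q + v * q ^ 2 = w * q ^ b"
    and e: "\<And>i j k. e i j k = 3 * int i ^ 2 - int i + 3 * int j ^ 2 + int b * int j + 3 * int k"
  shows "P (3 * N + 1) 0 t u v q =
    (\<Sum>(i, j, k, l)\<in>quads N. qmultinomial (q ^ 6) N [i, j, k, l] * t ^ i * w ^ j * qpow q (e i j k))"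
proof -
  have "P (3 * N + 1) 0 t u v q = quad_poly (q ^ 3) N (t * q ^ 2) (w * q ^ (b + 3))"
    unfolding P_3n_1_eq y by (simp add: power_add mult_ac)
  then show ?thesis unfolding quad_poly_monomials e by simp
qed

lemma P_3n_1_monomials':
  fixes s u v q w :: "'a::comm_ring_1"
  assumes y: "u * q + v * q ^ 2 = w * q ^ b"
    and e: "\<And>i j k. e i j k = 3 * int i ^ 2 - 2 * int i + 3 * int j ^ 2 + int b * int j + 3 * int k"
    and D: "\<And>i j k. j \<le> N \<Longrightarrow> qpow q (e i j k) * D i j
      = q ^ (3 * N + 1) * qpow q (3 * int i ^ 2 + (int b - 3) * int i + 3 * int j ^ 2 + int j + 3 * int k)"
  shows "P (3 * N + 1) s 0 u v q =
    (\<Sum>(i, j, k, l)\<in>quads N. qmultinomial (q ^ 6) N [i, j, k, l] * qpow q (e i j k)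
      * (s ^ i * w ^ j + s ^ (j + 1) * w ^ i * D i j))"
proof -
  let ?m = "\<lambda>i j k l. qmultinomial (q ^ 6) N [i, j, k, l]"
  define e' where "e' i j k
    = 3 * int i ^ 2 + (int b - 3) * int i + 3 * int j ^ 2 + int j + 3 * int k" for i j k
  have x: "s * q + 0 * q ^ 2 = s * q ^ 1" by simp
  have "P (3 * N + 1) s 0 u v q = quad_poly (q ^ 3) N (s * q ^ 1) (w * q ^ (b + 3))
      + s * q ^ (3 * N + 1) * quad_poly (q ^ 3) N (w * q ^ b) (s * q ^ (1 + 3))"
    unfolding P_3n_1_eq x y power_add by (simp only: mult_ac)
  also have "quad_poly (q ^ 3) N (s * q ^ 1) (w * q ^ (b + 3))
      = (\<Sum>(i, j, k, l)\<in>quads N. ?m i j k l * s ^ i * w ^ j * qpow q (e i j k))"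
    unfolding quad_poly_monomials e by simp
  also have "quad_poly (q ^ 3) N (w * q ^ b) (s * q ^ (1 + 3))
      = (\<Sum>(i, j, k, l)\<in>quads N. ?m i j k l * w ^ i * s ^ j * qpow q (e' i j k))"
    unfolding quad_poly_monomials e'_def by simp
  finally have "P (3 * N + 1) s 0 u v q = (\<Sum>(i, j, k, l)\<in>quads N.
      ?m i j k l * s ^ i * w ^ j * qpow q (e i j k)
      + ?m i j k l * s ^ (j + 1) * w ^ i * (q ^ (3 * N + 1) * qpow q (e' i j k)))"
    by (simp add: sum_distrib_left sum.distrib case_prod_beta mult_ac)
  also have "\<dots> = (\<Sum>(i, j, k, l)\<in>quads N. ?m i j k l * qpow q (e i j k)
      * (s ^ i * w ^ j + s ^ (j + 1) * w ^ i * D i j))"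
  proof (rule sum.cong[OF refl], clarify)
    fix i j k l
    assume "(i, j, k, l) \<in> quads N"
    then have "j \<le> N" by (simp add: quads_def)
    show "?m i j k l * s ^ i * w ^ j * qpow q (e i j k)
        + ?m i j k l * s ^ (j + 1) * w ^ i * (q ^ (3 * N + 1) * qpow q (e' i j k))
      = ?m i j k l * qpow q (e i j k) * (s ^ i * w ^ j + s ^ (j + 1) * w ^ i * D i j)"
      unfolding D[OF \<open>j \<le> N\<close>, of i k, folded e'_def, symmetric]
      by (simp only: ring_distribs mult_ac)
  qed
  finally show ?thesis .
qed

theorem theorem3p10:
  fixes s t u v q :: "'a::comm_ring_1" and N \<mu> :: nat
  assumes "\<mu> \<in> {0, 2}"
  shows
   "P (3 * N + \<mu>) 0 t u 0 q = (1 + of_nat (\<mu> div 2) * t * q ^ 2) *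
      (\<Sum>(i, j, k, l)\<in>quads N. qmultinomial (q ^ 6) N [i, j, k, l] * t ^ i * u ^ j *
         qpow q (3 * int i ^ 2 + (3 * int \<mu> - 1) * int i + 3 * int j ^ 2 + int j + 3 * int k))
  \<and> P (3 * N + \<mu>) s 0 0 v q = (1 + of_nat (\<mu> div 2) * s * q) *
      (\<Sum>(i, j, k, l)\<in>quads N. qmultinomial (q ^ 6) N [i, j, k, l] * s ^ i * v ^ j *
         qpow q (3 * int i ^ 2 + (3 * int \<mu> - 2) * int i + 3 * int j ^ 2 + 2 * int j + 3 * int k))
  \<and> P (3 * N + \<mu>) s 0 u 0 q = (1 + of_nat (\<mu> div 2) * s * q) *
      (\<Sum>(i, j, k, l)\<in>quads N. qmultinomial (q ^ 6) N [i, j, k, l] * s ^ i * u ^ j *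
         qpow q (3 * int i ^ 2 + (3 * int \<mu> - 2) * int i + 3 * int j ^ 2 + int j + 3 * int k))
  \<and> P (3 * N + \<mu>) 0 t 0 v q = (1 + of_nat (\<mu> div 2) * t * q ^ 2) *
      (\<Sum>(i, j, k, l)\<in>quads N. qmultinomial (q ^ 6) N [i, j, k, l] * t ^ i * v ^ j *
         qpow q (3 * int i ^ 2 + (3 * int \<mu> - 1) * int i + 3 * int j ^ 2 + 2 * int j + 3 * int k))
  \<and> P (3 * N + 1) 0 t u 0 q =
      (\<Sum>(i, j, k, l)\<in>quads N. qmultinomial (q ^ 6) N [i, j, k, l] * t ^ i * u ^ j *
         qpow q (3 * int i ^ 2 - int i + 3 * int j ^ 2 + int j + 3 * int k))
  \<and> P (3 * N + 1) s 0 0 v q =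
      (\<Sum>(i, j, k, l)\<in>quads N. qmultinomial (q ^ 6) N [i, j, k, l] *
         qpow q (3 * int i ^ 2 - 2 * int i + 3 * int j ^ 2 + 2 * int j + 3 * int k) *
         (s ^ i * v ^ j + s ^ (j + 1) * v ^ i * qpow q (int i - int j + 3 * int N + 1)))
  \<and> P (3 * N + 1) s 0 u 0 q =
      (\<Sum>(i, j, k, l)\<in>quads N. qmultinomial (q ^ 6) N [i, j, k, l] *
         qpow q (3 * int i ^ 2 - 2 * int i + 3 * int j ^ 2 + int j + 3 * int k) *
         (s ^ i * u ^ j + s ^ (j + 1) * u ^ i * q ^ (3 * N + 1)))
  \<and> P (3 * N + 1) 0 t 0 v q =
      (\<Sum>(i, j, k, l)\<in>quads N. qmultinomial (q ^ 6) N [i, j, k, l] * t ^ i * v ^ j *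
         qpow q (3 * int i ^ 2 - int i + 3 * int j ^ 2 + 2 * int j + 3 * int k))"
proof (intro conjI, goal_cases)
  case 1
  show ?case
    by (rule P_3n_mu_monomials[OF assms, where a = 2 and b = 1]) (simp_all add: algebra_simps)
next
  case 2
  show ?case
    by (rule P_3n_mu_monomials[OF assms, where a = 1 and b = 2]) (simp_all add: algebra_simps)
next
  case 3
  show ?case
    by (rule P_3n_mu_monomials[OF assms, where a = 1 and b = 1]) (simp_all add: algebra_simps)
next
  case 4
  show ?case
    by (rule P_3n_mu_monomials[OF assms, where a = 2 and b = 2]) (simp_all add: algebra_simps)
next
  case 5
  show ?case
    by (rule P_3n_1_monomials[where b = 1]) simp_all
next
  case 6
  have sq: "int i \<le> int i ^ 2" for i
    by (cases i) (simp_all add: power2_eq_square)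
  show ?case
  proof (rule P_3n_1_monomials'[where b = 2], goal_cases)
    case inner: (3 i j k)
    have "nat (3 * int i ^ 2 - 2 * int i + 3 * int j ^ 2 + 2 * int j + 3 * int k)
        + nat (int i - int j + 3 * int N + 1)
      = 3 * N + 1 + nat (3 * int i ^ 2 - int i + 3 * int j ^ 2 + int j + 3 * int k)"
      using sq[of i] sq[of j] inner by linarith
    from arg_cong[OF this, of "power q"] show ?case unfolding power_add by simp
  qed simp_all
next
  case 7
  show ?case
  proof (rule P_3n_1_monomials'[where b = 1], goal_cases)
    case (3 i j k)
    show ?case by (simp add: mult_ac)
  qed simp_all
next
  case 8
  show ?case
    by (rule P_3n_1_monomials[where b = 2]) simp_all
qed

end
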